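(* For all integers $k\ge 1$, $\mathcal{H}_k\simeq A_k$, where $\mathcal{H}_k$ is the $k$-th hydra function and $A_k$ is the $k$-th Ackermann function.
   Context: $\mathbb{N}=\{0,1,2,\ldots\}$. A hydra is a finite positive word on the alphabet $a_1,a_2,a_3,\ldots$. A strike transforms a non-empty hydra by removing its first letter and then replacing each remaining letter $a_i$ with $i>1$ by $a_ia_{i-1}$, leaving each $a_1$ unchanged. $\mathcal{H}(w)$ is the number of strikes needed to reduce the hydra $w$ to the empty word (this number is always finite). For integers $k\ge1$, $n\ge0$, the hydra functions are $\mathcal{H}_k(n):=\mathcal{H}(a_k^n)$. Ackermann's functions $A_k:\mathbb{N}\to\mathbb{N}$ are defined for integers $k,n\ge 0$ by: $A_0(n)=n+2$; $A_1(0)=0$; $A_k(0)=1$ for $k\ge 2$; and $A_{k+1}(n+1)=A_k(A_{k+1}(n))$ for $k,n\ge 0$. For $f,g:\mathbb{N}\to\mathbb{N}$, write $f\preceq g$ when there exists $C>0$ such that $f(n)\le Cg(Cn+C)+Cn+C$ for all $n$; write $f\simeq g$ when $f\preceq g$ and $g\preceq f$. *)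

theory Defs
  imports Main
begin

text \<open>A hydra is a finite word over \<open>a\<^sub>1, a\<^sub>2, \<dots>\<close>. It is encoded as the list of the
  indices of its letters, so the hydras are the lists with all entries at least 1. The index 0,
  which stands for no letter, is treated like 1 and never arises from a genuine hydra.\<close>

type_synonym hydra = "nat list"

definition grow_letter :: "nat \<Rightarrow> hydra" where
  "grow_letter i = (if i > 1 then [i, i - 1] else [i])"

definition grow :: "hydra \<Rightarrow> hydra" where
  "grow w = concat (map grow_letter w)"

text \<open>Strikes apply to non-empty hydras only; the empty word is made a fixed point so that
  iterating is total.\<close>

fun strike :: "hydra \<Rightarrow> hydra" where
  "strike [] = []"
| "strike (x # w) = grow w"

text \<open>The set of such \<open>m\<close> is never empty, by \<open>strikes_terminate\<close> below.\<close>

definition strikes_needed :: "hydra \<Rightarrow> nat" where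
  "strikes_needed w = (LEAST m. (strike ^^ m) w = [])"

definition hydra_fun :: "nat \<Rightarrow> nat \<Rightarrow> nat" where
  "hydra_fun k n = strikes_needed (replicate n k)"

fun ackermann :: "nat \<Rightarrow> nat \<Rightarrow> nat" where
  "ackermann 0 n = n + 2"
| "ackermann (Suc 0) 0 = 0"
| "ackermann (Suc (Suc k)) 0 = 1"
| "ackermann (Suc k) (Suc n) = ackermann k (ackermann (Suc k) n)"

text \<open>The constant \<open>C\<close> is a natural number because \<open>g\<close> is evaluated at \<open>C * n + C\<close>.\<close>

definition fun_preceq :: "(nat \<Rightarrow> nat) \<Rightarrow> (nat \<Rightarrow> nat) \<Rightarrow> bool" (infix "\<preceq>" 50) where
  "f \<preceq> g \<longleftrightarrow> (\<exists>C::nat. C > 0 \<and> (\<forall>n. f n \<le> C * g (C * n + C) + C * n + C))"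

definition fun_simeq :: "(nat \<Rightarrow> nat) \<Rightarrow> (nat \<Rightarrow> nat) \<Rightarrow> bool" (infix "\<simeq>" 50) where
  "f \<simeq> g \<longleftrightarrow> f \<preceq> g \<and> g \<preceq> f"

lemma grow_Nil [simp]: "grow [] = []"
  by (simp add: grow_def)

lemma grow_append: "grow (u @ v) = grow u @ grow v"
  by (simp add: grow_def)

lemma grow_pow_append: "(grow ^^ m) (u @ v) = (grow ^^ m) u @ (grow ^^ m) v"
  by (induction m) (simp_all add: grow_append)

lemma strike_append: "u \<noteq> [] \<Longrightarrow> strike (u @ v) = strike u @ grow v"
  by (cases u) (simp_all add: grow_append)

lemma strike_pow_append:
  "(strike ^^ m) u = [] \<Longrightarrow> \<exists>j. (strike ^^ j) (u @ v) = (grow ^^ j) v"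
proof (induction m arbitrary: u v)
  case 0
  then show ?case by (intro exI[of _ 0]) simp
next
  case (Suc m)
  show ?case
  proof (cases "u = []")
    case True
    then show ?thesis by (intro exI[of _ 0]) simp
  next
    case False
    have "(strike ^^ m) (strike u) = []"
      using Suc.prems by (simp only: funpow_Suc_right comp_apply)
    then obtain j where "(strike ^^ j) (strike u @ grow v) = (grow ^^ j) (grow v)"
      using Suc.IH by blast
    then have "(strike ^^ Suc j) (u @ v) = (grow ^^ Suc j) v"
      using False by (simp add: funpow_Suc_right strike_append del: funpow.simps)
    then show ?thesis by blast
  qed
qed

lemma grow_bound: "\<forall>x\<in>set w. x \<le> k \<Longrightarrow> \<forall>x\<in>set (grow w). x \<le> k"
  by (induction w) (auto simp: grow_def grow_letter_def)

lemma grow_pow_bound: "\<forall>x\<in>set w. x \<le> k \<Longrightarrow> \<forall>x\<in>set ((grow ^^ m) w). x \<le> k"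
  by (induction m) (simp_all add: grow_bound)

lemma grow_count: "\<forall>x\<in>set w. x \<le> k \<Longrightarrow> count_list (grow w) k = count_list w k"
  by (induction w) (auto simp: grow_def grow_letter_def)

lemma grow_pow_count:
  "\<forall>x\<in>set w. x \<le> k \<Longrightarrow> count_list ((grow ^^ m) w) k = count_list w k"
  by (induction m) (simp_all add: grow_count grow_pow_bound)

lemma grow_pow_Cons: "\<exists>t. (grow ^^ m) (x # v) = x # t"
  by (induction m) (auto simp: grow_def grow_letter_def)

lemma strikes_terminate_bounded:
  "\<forall>x\<in>set w. x < k \<Longrightarrow> \<exists>m. (strike ^^ m) w = []"
proof (induction k arbitrary: w)
  case 0
  then have "w = []" by (cases w) auto
  then show ?case by (intro exI[of _ 0]) simp
next
  case (Suc k)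
  have "\<forall>x\<in>set w. x \<le> k" using Suc.prems by auto
  then show ?case
  proof (induction "count_list w k" arbitrary: w rule: less_induct)
    case less
    show ?case
    proof (cases "k \<in> set w")
      case False
      then have "\<forall>x\<in>set w. x < k" using less.prems by (metis nat_less_le)
      then show ?thesis by (rule Suc.IH)
    next
      case True
      then obtain u v where w: "w = u @ k # v" and "k \<notin> set u"
        by (meson split_list_first)
      then have "\<forall>x\<in>set u. x < k"
        using less.prems by (metis Un_iff nat_less_le set_append)
      then obtain j where j: "(strike ^^ j) w = (grow ^^ j) (k # v)"
        using Suc.IH strike_pow_append w by metis
      obtain t where t: "(grow ^^ j) (k # v) = k # t"
        using grow_pow_Cons by blast
      have b: "\<forall>x\<in>set (k # v). x \<le> k" using less.prems w by simp
      have bt: "\<forall>x\<in>set t. x \<le> k"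
        using grow_pow_bound[OF b, of j] t by simp
      have "count_list t k + 1 = count_list (k # v) k"
        using grow_pow_count[OF b, of j] t by simp
      then have "count_list (grow t) k < count_list w k"
        using grow_count[OF bt] w by simp
      then obtain m where "(strike ^^ m) (grow t) = []"
        using less.hyps grow_bound[OF bt] by blast
      then have "(strike ^^ (m + Suc j)) w = []"
        using j t by (simp add: funpow_add funpow_swap1)
      then show ?thesis by blast
    qed
  qed
qed

lemma strikes_terminate: "\<exists>m. (strike ^^ m) w = []"
proof -
  have "\<forall>x\<in>set w. x < Suc (Max (set w))" by (simp add: le_imp_less_Suc)
  then show ?thesis by (rule strikes_terminate_bounded)
qed

end

theory Submission
  imports Defs
begin

text \<open>
  Growing commutes with concatenation, so the letters of a hydra evolve independently of each
  other until they become the head. A hydra is therefore processed letter by letter, and all that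
  matters about a letter \<open>a\<^sub>k\<close> is the time \<open>m\<close> at which the descendants of everything in front of
  it are gone: by then it has turned into \<open>\<theta>\<^sup>m(a\<^sub>k)\<close>, where \<open>\<theta>\<close> is the growth map. Let \<open>S\<^sub>k(m)\<close>
  (\<open>finish_time k m\<close>) be the time at which this word is gone in turn. Then
  \<open>\<H>\<^sub>k(n + 1) = S\<^sub>k(\<H>\<^sub>k(n))\<close>, and the identity
  \<open>\<theta>\<^sup>m\<^sup>+\<^sup>1(a\<^sub>k) = \<theta>\<^sup>m(a\<^sub>k) \<theta>\<^sup>m(a\<^sub>k\<^sub>-\<^sub>1)\<close> gives
  \<open>S\<^sub>k(m + 1) = S\<^sub>k\<^sub>-\<^sub>1(S\<^sub>k(m)) + 1\<close>, for \<open>k \<ge> 2\<close>, with \<open>S\<^sub>k(0) = 1\<close> and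
  \<open>S\<^sub>1(m) = m + 1\<close> (\<open>finish_time_Suc\<close>, \<open>hydra_fun_Suc\<close>). Up to the summand 1 this is Ackermann's recursion, so
  \<open>S\<^sub>k\<^sub>+\<^sub>1\<close> should behave like \<open>A\<^sub>k\<close>, and \<open>\<H>\<^sub>k\<close>, which iterates \<open>S\<^sub>k\<close>, like the function \<open>A\<^sub>k\<close>
  that iterates \<open>A\<^sub>k\<^sub>-\<^sub>1\<close>.

  For \<open>k \<ge> 2\<close> both directions cost only a shift of the argument. The extra summand
  can only help \<open>S\<close>, so \<open>A\<^sub>k(n) \<le> \<H>\<^sub>k(n + 1)\<close>. Conversely, the summand 1 and the shifts
  accumulated at lower levels are absorbed because \<open>A\<^sub>k\<close>, from argument 1 on, gains at least 2
  with each step (\<open>ackermann_absorbs_shift\<close>), which gives \<open>\<H>\<^sub>k(n) \<le> A\<^sub>k(n + c)\<close> for a constant \<open>c\<close>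
  depending on \<open>k\<close>. For \<open>k = 1\<close> both functions are linear.
\<close>

section \<open>Processing a hydra letter by letter\<close>

lemma strikes_needed_Nil [simp]: "strikes_needed [] = 0"
  by (simp add: strikes_needed_def)

lemma strikes_needed_Cons [simp]: "strikes_needed (x # w) = Suc (strikes_needed (grow w))"
proof -
  obtain m where m: "(strike ^^ m) (x # w) = []"
    using strikes_terminate by blast
  have "strikes_needed (x # w) = Suc (LEAST m. (strike ^^ Suc m) (x # w) = [])"
    unfolding strikes_needed_def
    using m by (intro Least_Suc[where P = "\<lambda>m. (strike ^^ m) (x # w) = []"]) simp_all
  also have "(\<lambda>m. (strike ^^ Suc m) (x # w) = []) = (\<lambda>m. (strike ^^ m) (grow w) = [])"
    by (simp add: funpow_Suc_right del: funpow.simps)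
  finally show ?thesis
    by (simp add: strikes_needed_def)
qed

text \<open>While \<open>u\<close> is being struck down, \<open>v\<close> is untouched by removals and merely grows once per
  strike.\<close>

lemma strikes_needed_append:
  "strikes_needed (u @ v) = strikes_needed u + strikes_needed ((grow ^^ strikes_needed u) v)"
proof (induction "strikes_needed u" arbitrary: u v rule: less_induct)
  case less
  show ?case
  proof (cases u)
    case (Cons x w)
    then show ?thesis
      using less[of "grow w" "grow v"] by (simp add: grow_append funpow_swap1)
  qed simp
qed

text \<open>Time is measured by the number of strikes since the letter \<open>k\<close> appeared, rather than from
  the moment \<open>m\<close> at which it becomes the head; with this convention consecutive letters compose
  without any correction term.\<close>

definition finish_time :: "nat \<Rightarrow> nat \<Rightarrow> nat" where
  "finish_time k m = m + strikes_needed ((grow ^^ m) [k])"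

lemma hydra_fun_0 [simp]: "hydra_fun k 0 = 0"
  by (simp add: hydra_fun_def)

lemma hydra_fun_Suc: "hydra_fun k (Suc n) = finish_time k (hydra_fun k n)"
proof -
  have "replicate (Suc n) k = replicate n k @ [k]"
    by (simp add: replicate_append_same)
  then show ?thesis
    by (simp only: hydra_fun_def finish_time_def strikes_needed_append)
qed

lemma finish_time_0 [simp]: "finish_time k 0 = 1"
  by (simp add: finish_time_def)

lemma finish_time_1 [simp]: "finish_time (Suc 0) m = Suc m"
proof -
  have "(grow ^^ m) [Suc 0] = [Suc 0]"
    by (induction m) (simp_all add: grow_def grow_letter_def)
  then show ?thesis
    by (simp add: finish_time_def)
qed

text \<open>After one growth step the letter \<open>a\<^sub>k\<^sub>+\<^sub>1\<close> is \<open>a\<^sub>k\<^sub>+\<^sub>1 a\<^sub>k\<close>. Counted from that step, the first of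
  the two letters is cleared at time \<open>finish_time (Suc k) m\<close>, which is when the second, equally
  old, becomes the head. The \<open>Suc\<close> accounts for the initial growth step.\<close>

lemma finish_time_Suc:
  assumes "k \<ge> 1"
  shows "finish_time (Suc k) (Suc m) = Suc (finish_time k (finish_time (Suc k) m))"
proof -
  let ?h = "strikes_needed ((grow ^^ m) [Suc k])"
  have "grow [Suc k] = [Suc k] @ [k]"
    using assms by (simp add: grow_def grow_letter_def)
  then have "(grow ^^ Suc m) [Suc k] = (grow ^^ m) [Suc k] @ (grow ^^ m) [k]"
    by (simp only: funpow_Suc_right comp_apply grow_pow_append)
  moreover have "(grow ^^ ?h) ((grow ^^ m) [k]) = (grow ^^ (m + ?h)) [k]"
    by (simp add: funpow_add add.commute[of m])
  ultimately show ?thesis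
    by (simp only: finish_time_def strikes_needed_append)
qed

lemma finish_time_greater: "m < finish_time k m"
proof -
  obtain t where "(grow ^^ m) [k] = k # t"
    using grow_pow_Cons by blast
  then show ?thesis
    by (simp add: finish_time_def)
qed

lemma mono_finish_time:
  assumes "k \<ge> 1"
  shows "mono (finish_time k)"
proof (cases "k = 1")
  case True
  then show ?thesis by (simp add: mono_def)
next
  case False
  with assms obtain j where j: "k = Suc j" "j \<ge> 1"
    by (cases k) auto
  show ?thesis
    unfolding j(1) mono_iff_le_Suc finish_time_Suc[OF j(2)]
    by (intro allI le_SucI less_imp_le finish_time_greater)
qed

lemma hydra_fun_1: "hydra_fun (Suc 0) n = n"
  by (induction n) (simp_all add: hydra_fun_Suc)

lemma finish_time_2: "finish_time (Suc (Suc 0)) m = 2 * m + 1"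
  by (induction m) (simp_all add: finish_time_Suc)

section \<open>Growth of Ackermann's functions\<close>

lemma ackermann_1: "ackermann (Suc 0) n = 2 * n"
  by (induction n) simp_all

lemma ackermann_ge_double: "k \<ge> 1 \<Longrightarrow> 2 * n \<le> ackermann k n"
proof (induction k arbitrary: n rule: nat_induct_at_least)
  case base
  then show ?case by (simp add: ackermann_1)
next
  case (Suc k)
  then obtain j where k: "k = Suc j"
    by (cases k) auto
  have step: "2 * ackermann (Suc k) n \<le> ackermann (Suc k) (Suc n)" for n
    using Suc.IH by (simp add: k)
  show ?case
  proof (induction n)
    case (Suc n)
    \<comment> \<open>Doubling the bound \<open>2 * n\<close> yields \<open>4 * n\<close>, which reaches \<open>2 * n + 2\<close> unless \<open>n = 0\<close>;
      there the exact value 1 is doubled instead.\<close>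
    show ?case
      using step[of n] Suc.IH by (cases n) (simp_all add: k)
  qed simp
qed

text \<open>The starting point \<open>n = 0\<close> has to be excluded: \<open>A\<^sub>k(0) = 1\<close> and \<open>A\<^sub>k(1) = 2\<close> for \<open>k \<ge> 2\<close>.\<close>

lemma ackermann_step:
  assumes "k \<ge> 1" "n \<ge> 1"
  shows "ackermann k n + 2 \<le> ackermann k (Suc n)"
proof (cases "k = 1")
  case True
  then show ?thesis by (simp add: ackermann_1)
next
  case False
  then obtain j where k: "k = Suc j" "j \<ge> 1"
    using assms(1) by (cases k) auto
  have "2 * ackermann k n \<le> ackermann k (Suc n)"
    using ackermann_ge_double[OF k(2), of "ackermann k n"] by (simp add: k(1))
  then show ?thesis
    using ackermann_ge_double[OF assms(1), of n] assms(2) by linarith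
qed

lemma ackermann_add:
  assumes "k \<ge> 1" "n \<ge> 1"
  shows "ackermann k n + 2 * e \<le> ackermann k (n + e)"
proof (induction e)
  case (Suc e)
  then show ?case
    using ackermann_step[OF assms(1), of "n + e"] assms(2) by simp
qed simp

lemma mono_ackermann:
  assumes "k \<ge> 1"
  shows "mono (ackermann k)"
  unfolding mono_iff_le_Suc
proof
  fix n
  show "ackermann k n \<le> ackermann k (Suc n)"
  proof (cases "n = 0")
    case True
    obtain j where k: "k = Suc j"
      using assms by (cases k) auto
    have "ackermann k 0 \<le> 1"
      unfolding k by (cases j) simp_all
    then show ?thesis
      using True ackermann_ge_double[OF assms, of 1] by simp
  next
    case False
    then show ?thesis
      using ackermann_step[OF assms, of n] by simp
  qed
qed

section \<open>Comparing the two recursions\<close>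

lemma ackermann_le_finish_time: "k \<ge> 1 \<Longrightarrow> ackermann k m \<le> finish_time (Suc k) m"
proof (induction k arbitrary: m rule: nat_induct_at_least)
  case base
  then show ?case by (simp add: ackermann_1 finish_time_2)
next
  case (Suc k)
  note IH = Suc.IH
  from Suc.hyps obtain j where k: "k = Suc j"
    by (cases k) auto
  show ?case
  proof (induction m)
    case 0
    then show ?case by (simp add: k)
  next
    case (Suc m)
    have "ackermann (Suc k) (Suc m) = ackermann k (ackermann (Suc k) m)"
      by (simp add: k)
    also have "\<dots> \<le> finish_time (Suc k) (ackermann (Suc k) m)"
      by (rule IH)
    also have "\<dots> \<le> finish_time (Suc k) (finish_time (Suc (Suc k)) m)"
      using Suc.IH by (intro monoD[OF mono_finish_time]) simp_all
    finally show ?case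
      by (simp add: finish_time_Suc)
  qed
qed

lemma ackermann_le_hydra_fun:
  assumes "k \<ge> 2"
  shows "ackermann k n \<le> hydra_fun k (Suc n)"
proof -
  obtain j where k: "k = Suc (Suc j)"
    using assms le_Suc_ex[of 2 k] by auto
  show ?thesis
  proof (induction n)
    case 0
    then show ?case by (simp add: k hydra_fun_Suc)
  next
    case (Suc n)
    have "ackermann k (Suc n) = ackermann (Suc j) (ackermann k n)"
      by (simp add: k)
    also have "\<dots> \<le> finish_time k (ackermann k n)"
      unfolding k by (rule ackermann_le_finish_time) simp
    also have "\<dots> \<le> finish_time k (hydra_fun k (Suc n))"
      using Suc.IH assms by (intro monoD[OF mono_finish_time]) simp_all
    finally show ?case
      by (simp add: hydra_fun_Suc)
  qed
qed

text \<open>Iterating \<open>x \<mapsto> A\<^sub>k(x + e)\<close> instead of \<open>A\<^sub>k\<close> only shifts the argument of \<open>A\<^sub>k\<^sub>+\<^sub>1\<close>. The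
  induction works for \<open>f m + 2 * e\<close>: of the surplus \<open>2 * e\<close>, one \<open>e\<close> pays for the shift at the
  next step, and the other \<open>e\<close> reproduces the full surplus, since \<open>A\<^sub>k\<close> has slope at least 2. The offset \<open>f 0 + 2 * e\<close> starts
  the induction because \<open>A\<^sub>k\<^sub>+\<^sub>1\<close> dominates the identity.\<close>

lemma ackermann_absorbs_shift:
  assumes "k \<ge> 1" "e \<ge> 1"
    and step: "\<And>m. f (Suc m) \<le> ackermann k (f m + e)"
  shows "f m + 2 * e \<le> ackermann (Suc k) (m + (f 0 + 2 * e))"
proof (induction m)
  case 0
  have "2 * (f 0 + 2 * e) \<le> ackermann (Suc k) (f 0 + 2 * e)"
    by (rule ackermann_ge_double) simp
  then show ?case by simp
next
  case (Suc m)
  have "f (Suc m) + 2 * e \<le> ackermann k (f m + e) + 2 * e"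
    using step by simp
  also have "\<dots> \<le> ackermann k (f m + 2 * e)"
    using ackermann_add[OF assms(1), of "f m + e" e] assms(2) by (simp add: mult_2 add.assoc)
  also have "\<dots> \<le> ackermann k (ackermann (Suc k) (m + (f 0 + 2 * e)))"
    using Suc.IH by (rule monoD[OF mono_ackermann[OF assms(1)]])
  also have "\<dots> = ackermann (Suc k) (Suc m + (f 0 + 2 * e))"
    using assms(1) by (cases k) simp_all
  finally show ?case .
qed

text \<open>Taking \<open>c\<close> positive keeps the arguments of \<open>A\<^sub>k\<close> where its slope is at least 2; there the
  additional strike in the recursion for \<open>S\<^sub>k\<^sub>+\<^sub>2\<close> is paid by enlarging the shift by one.\<close>

lemma finish_time_le_ackermann:
  "k \<ge> 1 \<Longrightarrow> \<exists>c\<ge>1. \<forall>m. finish_time (Suc k) m \<le> ackermann k (m + c)"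
proof (induction k rule: nat_induct_at_least)
  case base
  show ?case
    by (intro exI[of _ 1]) (simp add: ackermann_1 finish_time_2)
next
  case (Suc k)
  then obtain c where c: "c \<ge> 1" "\<And>m. finish_time (Suc k) m \<le> ackermann k (m + c)"
    by blast
  let ?f = "finish_time (Suc (Suc k))"
  have step: "?f (Suc m) \<le> ackermann k (?f m + Suc c)" for m
  proof -
    have "?f (Suc m) \<le> Suc (ackermann k (?f m + c))"
      using c(2) by (simp add: finish_time_Suc)
    also have "\<dots> \<le> ackermann k (?f m + Suc c)"
      using ackermann_step[of k "?f m + c"] Suc.hyps c(1) by simp
    finally show ?thesis .
  qed
  have "?f m \<le> ackermann (Suc k) (m + (?f 0 + 2 * Suc c))" for m
    using ackermann_absorbs_shift[of k "Suc c" ?f, OF Suc.hyps _ step, of m] by simp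
  then show ?case
    by (intro exI[of _ "?f 0 + 2 * Suc c"]) simp
qed

lemma hydra_fun_le_ackermann:
  assumes "k \<ge> 2"
  shows "\<exists>c. \<forall>n. hydra_fun k n \<le> ackermann k (n + c)"
proof -
  obtain j where k: "k = Suc j" "j \<ge> 1"
    using assms by (cases k) auto
  obtain c where c: "c \<ge> 1" "\<And>m. finish_time k m \<le> ackermann j (m + c)"
    using finish_time_le_ackermann[OF k(2)] k(1) by blast
  have "hydra_fun k n \<le> ackermann k (n + 2 * c)" for n
    using ackermann_absorbs_shift[of j c "hydra_fun k", OF k(2) c(1), of n] c(2)
    by (simp add: hydra_fun_Suc k(1))
  then show ?thesis by blast
qed

theorem proposition1p2:
  fixes k :: nat
  assumes "k \<ge> 1"
  shows "hydra_fun k \<simeq> ackermann k"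
proof (cases "k = 1")
  case True
  show ?thesis
    unfolding fun_simeq_def fun_preceq_def True
    by (intro conjI exI[of _ 2]) (simp_all add: hydra_fun_1 ackermann_1)
next
  case False
  with assms have k: "k \<ge> 2" by simp
  obtain c where c: "\<And>n. hydra_fun k n \<le> ackermann k (n + c)"
    using hydra_fun_le_ackermann[OF k] by blast
  have "hydra_fun k n \<le> Suc c * ackermann k (Suc c * n + Suc c) + Suc c * n + Suc c" for n
  proof -
    have "hydra_fun k n \<le> ackermann k (Suc c * n + Suc c)"
      using c[of n] monoD[OF mono_ackermann[OF assms], of "n + c" "Suc c * n + Suc c"] by simp
    then show ?thesis by simp
  qed
  then have "hydra_fun k \<preceq> ackermann k"
    unfolding fun_preceq_def by (intro exI[of _ "Suc c"]) simp
  moreover have "ackermann k n \<le> 1 * hydra_fun k (1 * n + 1) + 1 * n + 1" for n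
    using ackermann_le_hydra_fun[OF k, of n] by simp
  then have "ackermann k \<preceq> hydra_fun k"
    unfolding fun_preceq_def by (intro exI[of _ 1]) simp
  ultimately show ?thesis
    by (simp add: fun_simeq_def)
qed

end
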